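(* Let $A$ be a coherent quantale. Then $Min_Z(A)$ is a zero-dimensional Hausdorff space and $Min_F(A)$ is a compact $T_1$ space.
   Context: A quantale here means a complete lattice $A$ with bottom $0$ and top $1$, with an associative commutative multiplication that distributes over arbitrary joins and has $1$ as unit. $K(A)$ is the set of compact elements. $A$ is coherent if every element is a join of compact elements, $1\in K(A)$, and $K(A)$ is closed under multiplication. An element $p<1$ is $m$-prime if for all $a,b\in A$, $ab\leq p$ implies $a\leq p$ or $b\leq p$; $Spec(A)$ is the set of $m$-prime elements and $Min(A)$ is the set of minimal elements of $Spec(A)$. For $a\in A$, $V(a)=\{p\in Spec(A): a\leq p\}$. $Spec_Z(A)$ is $Spec(A)$ with the topology whose closed sets are the $V(a)$, $a\in A$; $Spec_F(A)$ is $Spec(A)$ with the flat topology, having $\{V(c): c\in K(A)\}$ as a basis of open sets. $Min_Z(A)$ and $Min_F(A)$ are $Min(A)$ as a subspace of $Spec_Z(A)$, respectively $Spec_F(A)$. Compact means every open cover has a finite subcover (no separation assumed); zero-dimensional means having a basis of clopen sets. *)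

theory Defs
  imports "HOL-Analysis.Analysis"
begin

section \<open>Coherent quantales\<close>

text \<open>Quantales are commutative and integral: the unit of the multiplication is the top element.
  The bottom and top elements of the lattice are \<^term>\<open>bot\<close> and \<^term>\<open>top\<close>;
  the one-element quantale is allowed.\<close>

class quantale = complete_lattice + comm_monoid_mult +
  assumes one_eq_top: "1 = top"
    and mult_Sup_distrib: "a * Sup S = Sup ((\<lambda>s. a * s) ` S)"

definition (in complete_lattice) compact_elements :: "'a set"
  where "compact_elements = {c. \<forall>S. c \<le> Sup S \<longrightarrow> (\<exists>F\<subseteq>S. finite F \<and> c \<le> Sup F)}"

class coherent_quantale = quantale +
  assumes Sup_of_compact: "\<exists>S\<subseteq>compact_elements. a = Sup S"
    and one_compact: "1 \<in> compact_elements"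
    and mult_compact: "\<lbrakk>c \<in> compact_elements; d \<in> compact_elements\<rbrakk> \<Longrightarrow> c * d \<in> compact_elements"

section \<open>The m-prime spectrum and its topologies\<close>

definition m_prime :: "'a::quantale \<Rightarrow> bool"
  where "m_prime p \<longleftrightarrow> p < 1 \<and> (\<forall>a b. a * b \<le> p \<longrightarrow> a \<le> p \<or> b \<le> p)"

definition Spec :: "'a::quantale set"
  where "Spec = {p. m_prime p}"

definition Min_Spec :: "'a::quantale set"
  where "Min_Spec = {p \<in> Spec. \<forall>q\<in>Spec. q \<le> p \<longrightarrow> q = p}"

definition V :: "'a::quantale \<Rightarrow> 'a set"
  where "V a = {p \<in> Spec. a \<le> p}"

definition Spec_Z :: "'a::quantale topology"
  where "Spec_Z = topology (\<lambda>U. \<exists>a. U = Spec - V a)"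

definition Spec_F :: "'a::quantale topology"
  where "Spec_F = topology (arbitrary union_of (\<lambda>U. \<exists>c\<in>compact_elements. U = V c))"

definition Min_Z :: "'a::quantale topology"
  where "Min_Z = subtopology Spec_Z Min_Spec"

definition Min_F :: "'a::quantale topology"
  where "Min_F = subtopology Spec_F Min_Spec"

definition zero_dimensional_space :: "'a topology \<Rightarrow> bool"
  where "zero_dimensional_space X \<longleftrightarrow>
    (\<exists>\<B>. (\<forall>B\<in>\<B>. openin X B \<and> closedin X B) \<and> openin X = arbitrary union_of (\<lambda>U. U \<in> \<B>))"

text \<open>The function \<^const>\<open>topology\<close> is only meaningful on predicates satisfying
  \<^const>\<open>istopology\<close>; the following facts show that both spectra carry the intended topology.\<close>

lemma V_subset: "V a \<subseteq> Spec"
  by (auto simp: V_def)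

lemma mult_le_left: "a * b \<le> (a::'a::quantale)"
proof -
  have "Sup {b, 1} = (1::'a)"
    by (simp add: one_eq_top)
  then have "a = Sup ((\<lambda>s. a * s) ` {b, 1})"
    using mult_Sup_distrib[of a "{b, 1}"] by (simp del: Sup_insert)
  then show ?thesis
    by (metis Sup_upper imageI insertI1)
qed

lemma V_mult: "V (a * b) = V a \<union> V (b::'a::quantale)"
proof
  show "V (a * b) \<subseteq> V a \<union> V b"
    unfolding V_def Spec_def m_prime_def by blast
  have "a * b \<le> a" "a * b \<le> b"
    using mult_le_left[of a b] mult_le_left[of b a] by (simp_all only: mult.commute[of b a])
  then show "V a \<union> V b \<subseteq> V (a * b)"
    unfolding V_def using order_trans by blast
qed

lemma V_Sup: "V (Sup S) = {p \<in> Spec. \<forall>a\<in>S. p \<in> V a}"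
  by (auto simp: V_def Sup_le_iff)

lemma V_sup: "V (sup a b) = V a \<inter> V b"
  by (auto simp: V_def)

lemma V_bot: "V bot = Spec"
  by (auto simp: V_def)

lemma sup_compact:
  fixes c d :: "'a::complete_lattice"
  assumes "c \<in> compact_elements" "d \<in> compact_elements"
  shows "sup c d \<in> compact_elements"
  unfolding compact_elements_def
proof (clarify)
  fix S assume "sup c d \<le> Sup S"
  then have "c \<le> Sup S" "d \<le> Sup S" by auto
  then obtain F G where "F \<subseteq> S" "finite F" "c \<le> Sup F" "G \<subseteq> S" "finite G" "d \<le> Sup G"
    using assms unfolding compact_elements_def by blast
  then have "F \<union> G \<subseteq> S" "finite (F \<union> G)" "sup c d \<le> Sup (F \<union> G)"
    by (simp_all add: Sup_union_distrib le_supI1 le_supI2)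
  then show "\<exists>F\<subseteq>S. finite F \<and> sup c d \<le> Sup F" by blast
qed

lemma bot_compact: "(bot::'a::complete_lattice) \<in> compact_elements"
  unfolding compact_elements_def by (blast intro: bot_least)

lemma openin_Spec_Z: "openin Spec_Z U \<longleftrightarrow> (\<exists>a. U = Spec - V a)"
proof -
  have "istopology (\<lambda>U. \<exists>a::'a. U = Spec - V a)"
    unfolding istopology_def
  proof (intro conjI allI impI)
    fix S T :: "'a set" assume "\<exists>a. S = Spec - V a" "\<exists>a. T = Spec - V a"
    then obtain a b where "S = Spec - V a" "T = Spec - V b" by blast
    then have "S \<inter> T = Spec - V (a * b)" by (auto simp: V_mult)
    then show "\<exists>a. S \<inter> T = Spec - V a" by blast
  next
    fix \<K> :: "'a set set" assume "\<forall>K\<in>\<K>. \<exists>a. K = Spec - V a"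
    then obtain f where f: "\<And>K. K \<in> \<K> \<Longrightarrow> K = Spec - V (f K)" by metis
    have "\<Union>\<K> = (\<Union>K\<in>\<K>. Spec - V (f K))"
      using f by blast
    also have "\<dots> = Spec - V (Sup (f ` \<K>))" by (auto simp: V_Sup)
    finally show "\<exists>a. \<Union>\<K> = Spec - V a" by blast
  qed
  then show ?thesis by (simp add: Spec_Z_def topology_inverse')
qed

lemma openin_Spec_F:
  "openin Spec_F = arbitrary union_of (\<lambda>U. \<exists>c\<in>compact_elements. U = V c)"
proof -
  have "istopology (arbitrary union_of (\<lambda>U::'a set. \<exists>c\<in>compact_elements. U = V c))"
  proof (rule istopology_base)
    fix S T :: "'a set"
    assume "\<exists>c\<in>compact_elements. S = V c" "\<exists>c\<in>compact_elements. T = V c"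
    then show "\<exists>c\<in>compact_elements. S \<inter> T = V c" by (metis V_sup sup_compact)
  qed
  then show ?thesis by (simp add: Spec_F_def topology_inverse')
qed

lemma V_one: "V (1::'a::quantale) = {}"
  by (auto simp: V_def Spec_def m_prime_def)

lemma topspace_Spec_Z: "topspace Spec_Z = Spec"
proof
  show "topspace Spec_Z \<subseteq> Spec" by (auto simp: topspace_def openin_Spec_Z)
  have "openin Spec_Z Spec" unfolding openin_Spec_Z by (rule exI[of _ 1]) (simp add: V_one)
  then show "Spec \<subseteq> topspace Spec_Z" by (rule openin_subset)
qed

lemma closedin_Spec_Z: "closedin Spec_Z C \<longleftrightarrow> (\<exists>a. C = V a)"
proof
  assume "closedin Spec_Z C"
  then obtain a where "C \<subseteq> Spec" "Spec - C = Spec - V a"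
    unfolding closedin_def topspace_Spec_Z openin_Spec_Z by blast
  then have "C = V a" using V_subset[of a] by blast
  then show "\<exists>a. C = V a" ..
next
  assume "\<exists>a. C = V a"
  then show "closedin Spec_Z C"
    using V_subset unfolding closedin_def topspace_Spec_Z openin_Spec_Z by blast
qed

lemma topspace_Spec_F: "topspace Spec_F = Spec"
proof
  show "topspace Spec_F \<subseteq> Spec"
    using V_subset unfolding topspace_def openin_Spec_F union_of_def by blast
  have "openin Spec_F Spec"
    unfolding openin_Spec_F by (rule arbitrary_union_of_inc) (metis V_bot bot_compact)
  then show "Spec \<subseteq> topspace Spec_F" by (rule openin_subset)
qed

end

(* Two applications of one existence lemma: a multiplicatively closed set S of compact elements
   with bot \<notin> S is avoided by some m-prime element, namely a maximal element among those above
   no element of S.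
   If p is minimal and c \<le> p is compact, take for S the compact s with V s \<subseteq> V c \<union> V d for some
   compact d not below p. An m-prime avoiding S would lie below p and not above c, so bot \<in> S and
   Spec = V c \<union> V d. Hence V c is clopen in Min_Z, which gives zero-dimensionality. Distinct
   minimal m-primes are incomparable, so some V c with c compact contains just the first of them;
   this gives both the Hausdorff property of Min_Z and the T1 property of Min_F.
   If Min_Spec is covered by the V c with c \<in> C, take for S the compact s with V s covered by
   finitely many of them. An m-prime avoiding S would have a minimal m-prime below it lying in no
   V c, so bot \<in> S and finitely many V c cover Spec. *)
theory Submission
  imports Defs
begin

section \<open>Chains, products and compact elements\<close>

lemma Chains_relation_ofD:
  assumes "C \<in> Chains (relation_of P A)"
  shows "C \<subseteq> A" and "\<And>x y. x \<in> C \<Longrightarrow> y \<in> C \<Longrightarrow> P x y \<or> P y x"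
  using assms unfolding Chains_def relation_of_def by blast+

lemma mult_sup_distrib: "a * sup b c = sup (a * b) (a * (c::'a::quantale))"
  using mult_Sup_distrib[of a "{b, c}"] by simp

lemma mult_right_mono_quantale: "b \<le> c \<Longrightarrow> a * b \<le> a * (c::'a::quantale)"
  by (metis mult_sup_distrib sup.orderE sup.orderI sup_commute)

lemma mult_mono_quantale: "a \<le> b \<Longrightarrow> c \<le> d \<Longrightarrow> a * c \<le> b * (d::'a::quantale)"
  by (metis mult_right_mono_quantale mult.commute order_trans)

text \<open>Distributivity expands the product into \<open>p * p\<close>, \<open>p * b\<close>,
  \<open>a * p\<close> and \<open>a * b\<close>; the first three lie below \<open>p\<close> because
  a product is below each factor. This makes a maximal avoiding element m-prime.\<close>

lemma mult_sup_le: "a * b \<le> p \<Longrightarrow> sup p a * sup p b \<le> (p::'a::quantale)"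
  by (simp add: mult_sup_distrib mult_le_left mult.commute[of "sup p a"])
    (metis mult_le_left mult.commute)

text \<open>Coherence enters here: \<open>a\<close> is a join of compact elements, so comparisons
  can be tested on those below \<open>a\<close>.\<close>

lemma le_if_compact_le:
  fixes a b :: "'a::coherent_quantale"
  assumes "\<And>c. c \<in> compact_elements \<Longrightarrow> c \<le> a \<Longrightarrow> c \<le> b"
  shows "a \<le> b"
proof -
  obtain S where "S \<subseteq> compact_elements" "a = Sup S"
    using Sup_of_compact by blast
  then show ?thesis
    using assms by (auto intro!: Sup_least simp: Sup_upper)
qed

text \<open>A nonempty finite subset of a chain contains its own join. The assumption
  \<open>c \<noteq> bot\<close> rules out the empty subset.\<close>

lemma compact_le_Sup_chain:
  fixes c :: "'a::complete_lattice"
  assumes c: "c \<in> compact_elements" "c \<le> Sup C" "c \<noteq> bot"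
    and chain: "\<And>x y. x \<in> C \<Longrightarrow> y \<in> C \<Longrightarrow> x \<le> y \<or> y \<le> x"
  obtains x where "x \<in> C" "c \<le> x"
proof -
  obtain F where F: "F \<subseteq> C" "finite F" "c \<le> Sup F"
    using c unfolding compact_elements_def by blast
  from F(2,1) have "F = {} \<or> Sup F \<in> C"
  proof (induction F)
    case (insert x F)
    then show ?case
      using chain[of x "Sup F"] by (auto simp: sup_absorb1 sup_absorb2)
  qed simp
  then show ?thesis
    using F c(3) that by (metis Sup_empty bot.extremum_unique)
qed

section \<open>Existence of m-prime and minimal m-prime elements\<close>

lemma exists_m_prime_avoiding:
  fixes S :: "'a::quantale set"
  assumes S: "S \<subseteq> compact_elements" "1 \<in> S" "bot \<notin> S"
    and mult: "\<And>s t. s \<in> S \<Longrightarrow> t \<in> S \<Longrightarrow> s * t \<in> S"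
  obtains p where "p \<in> Spec" "\<And>s. s \<in> S \<Longrightarrow> \<not> s \<le> p"
proof -
  let ?A = "{x. \<forall>s\<in>S. \<not> s \<le> x}"
  have "\<exists>m\<in>?A. \<forall>a\<in>?A. m \<le> a \<longrightarrow> a = m"
  proof (rule predicate_Zorn)
    show "partial_order_on ?A (relation_of (\<le>) ?A)"
      by (rule partial_order_on_relation_ofI) auto
    fix C assume "C \<in> Chains (relation_of (\<le>) ?A)"
    note C = Chains_relation_ofD[OF this]
    \<comment> \<open>Compactness of \<open>s\<close> would put it below a single member of the
      chain. For the empty chain the join is \<open>bot\<close>, which is covered by
      \<open>bot \<notin> S\<close>.\<close>
    have "\<not> s \<le> Sup C" if "s \<in> S" for s
    proof
      assume "s \<le> Sup C"
      moreover have "s \<in> compact_elements" "s \<noteq> bot"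
        using S that by auto
      ultimately obtain x where "x \<in> C" "s \<le> x"
        using compact_le_Sup_chain[OF _ _ _ C(2)] by blast
      then show False using C(1) that by blast
    qed
    then show "\<exists>u\<in>?A. \<forall>a\<in>C. a \<le> u"
      by (intro bexI[of _ "Sup C"]) (auto intro: Sup_upper)
  qed
  then obtain p where avoid: "\<And>s. s \<in> S \<Longrightarrow> \<not> s \<le> p"
    and max: "\<And>x. \<forall>s\<in>S. \<not> s \<le> x \<Longrightarrow> p \<le> x \<Longrightarrow> x = p"
    by blast
  have "a \<le> p \<or> b \<le> p" if ab: "a * b \<le> p" for a b
  proof (rule ccontr)
    assume "\<not> (a \<le> p \<or> b \<le> p)"
    \<comment> \<open>Both joins are strictly above \<open>p\<close>, so by maximality each lies
      above some element of \<open>S\<close>; the product of these two elements then falls below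
      \<open>p\<close>.\<close>
    then have "sup p a \<noteq> p" "sup p b \<noteq> p"
      by (metis sup_ge2)+
    then obtain s t where st: "s \<in> S" "t \<in> S" "s \<le> sup p a" "t \<le> sup p b"
      using max[of "sup p a"] max[of "sup p b"] sup_ge1 by blast
    then have "s * t \<le> p"
      using mult_mono_quantale mult_sup_le[OF ab] order_trans by blast
    then show False
      using avoid mult st by blast
  qed
  moreover have "p < 1"
    using avoid[OF S(2)] by (simp add: one_eq_top less_top top_unique)
  ultimately show ?thesis
    using that avoid unfolding Spec_def m_prime_def by blast
qed

lemma Inf_chain_in_Spec:
  fixes C :: "'a::quantale set"
  assumes C: "C \<subseteq> Spec" "C \<noteq> {}"
    and chain: "\<And>x y. x \<in> C \<Longrightarrow> y \<in> C \<Longrightarrow> x \<le> y \<or> y \<le> x"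
  shows "Inf C \<in> Spec"
proof -
  have "a \<le> Inf C \<or> b \<le> Inf C" if ab: "a * b \<le> Inf C" for a b
  proof (rule ccontr)
    assume "\<not> ?thesis"
    then obtain x y where xy: "x \<in> C" "y \<in> C" "\<not> a \<le> x" "\<not> b \<le> y"
      unfolding le_Inf_iff by blast
    \<comment> \<open>The smaller of \<open>x\<close> and \<open>y\<close> is above neither
      \<open>a\<close> nor \<open>b\<close>.\<close>
    then obtain z where z: "z \<in> C" "\<not> a \<le> z" "\<not> b \<le> z"
      using chain[of x y] order_trans by metis
    have "a * b \<le> z"
      using ab z(1) by (simp add: le_Inf_iff)
    then show False
      using z C(1) unfolding Spec_def m_prime_def by blast
  qed
  moreover have "Inf C < 1"
  proof -
    obtain x where "x \<in> C" using C(2) by blast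
    then show ?thesis
      using C(1) Inf_lower[of x C] unfolding Spec_def m_prime_def by (auto intro: le_less_trans)
  qed
  ultimately show ?thesis
    unfolding Spec_def m_prime_def by blast
qed

lemma exists_Min_Spec_le:
  fixes p :: "'a::quantale"
  assumes p: "p \<in> Spec"
  obtains q where "q \<in> Min_Spec" "q \<le> p"
proof -
  let ?A = "{q \<in> Spec. q \<le> p}"
  have "\<exists>m\<in>?A. \<forall>a\<in>?A. m \<ge> a \<longrightarrow> a = m"
  proof (rule predicate_Zorn)
    \<comment> \<open>Zorn's lemma is applied to the reversed order, so its maximal elements are
      minimal m-primes.\<close>
    show "partial_order_on ?A (relation_of (\<ge>) ?A)"
      by (rule partial_order_on_relation_ofI) auto
    fix C assume "C \<in> Chains (relation_of (\<ge>) ?A)"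
    note C = Chains_relation_ofD[OF this]
    show "\<exists>u\<in>?A. \<forall>a\<in>C. u \<le> a"
    proof (cases "C = {}")
      case True
      \<comment> \<open>The infimum of the empty chain is \<open>top\<close>, which is not m-prime;
        \<open>p\<close> itself serves as the bound.\<close>
      then show ?thesis using p by blast
    next
      case False
      then obtain x where x: "x \<in> C" by blast
      have "Inf C \<in> Spec"
        using C False by (intro Inf_chain_in_Spec) blast+
      moreover have "Inf C \<le> p"
        using x C(1) Inf_lower order_trans by blast
      ultimately show ?thesis
        by (intro bexI[of _ "Inf C"]) (auto intro: Inf_lower)
    qed
  qed
  then show ?thesis
    using that unfolding Min_Spec_def by (smt (verit) mem_Collect_eq order_trans)
qed

section \<open>Covers of the spectrum by sets \<open>V c\<close>\<close>

lemma Min_Spec_complement: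
  fixes p c :: "'a::coherent_quantale"
  assumes p: "p \<in> Min_Spec" and c: "c \<in> compact_elements" "c \<le> p"
  obtains d where "d \<in> compact_elements" "\<not> d \<le> p" "Spec = V c \<union> V d"
proof -
  define S where "S = {s \<in> compact_elements. \<exists>d\<in>compact_elements. \<not> d \<le> p \<and> V s \<subseteq> V c \<union> V d}"
  have pS: "p \<in> Spec" "\<not> 1 \<le> p" and prime: "\<And>a b. a * b \<le> p \<Longrightarrow> a \<le> p \<or> b \<le> p"
    using p unfolding Min_Spec_def Spec_def m_prime_def by auto
  \<comment> \<open>The witness is \<open>d = 1\<close>. This is used for \<open>s = 1\<close>,
    where \<open>V 1\<close> is empty, and for \<open>s = c\<close>.\<close>
  have one: "s \<in> S" if "s \<in> compact_elements" "V s \<subseteq> V c" for s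
    unfolding S_def using that pS one_compact by blast
  have "bot \<in> S"
  proof (rule ccontr)
    assume "bot \<notin> S"
    have mult: "s * t \<in> S" if st: "s \<in> S" "t \<in> S" for s t
    proof -
      obtain d e where "d \<in> compact_elements" "e \<in> compact_elements" "\<not> d \<le> p" "\<not> e \<le> p"
        "V s \<subseteq> V c \<union> V d" "V t \<subseteq> V c \<union> V e"
        using st unfolding S_def by blast
      \<comment> \<open>Primeness of \<open>p\<close> keeps \<open>d * e\<close> from lying below
        \<open>p\<close>, while \<open>V\<close> turns products into unions.\<close>
      then have "d * e \<in> compact_elements" "\<not> d * e \<le> p" "V (s * t) \<subseteq> V c \<union> V (d * e)"
        using prime mult_compact by (auto simp: V_mult)
      then show ?thesis
        using st mult_compact unfolding S_def by blast
    qed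
    have "S \<subseteq> compact_elements"
      unfolding S_def by blast
    moreover have "1 \<in> S"
      by (rule one[OF one_compact]) (simp add: V_one)
    ultimately
    obtain q where q: "q \<in> Spec" "\<And>s. s \<in> S \<Longrightarrow> \<not> s \<le> q"
      using exists_m_prime_avoiding[OF _ _ \<open>bot \<notin> S\<close> mult] by blast
    have "q \<le> p"
    proof (rule le_if_compact_le, rule ccontr)
      fix e assume e: "e \<in> compact_elements" "e \<le> q" "\<not> e \<le> p"
      \<comment> \<open>Here \<open>e\<close> is its own witness \<open>d\<close>.\<close>
      then have "e \<in> S"
        unfolding S_def by blast
      then show False
        using q(2) e(2) by blast
    qed
    then have "q = p"
      using p q(1) unfolding Min_Spec_def by blast
    then show False
      using q(2) one c by blast
  qed
  \<comment> \<open>Since \<open>V bot = Spec\<close>, membership of \<open>bot\<close> in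
    \<open>S\<close> is exactly the required cover.\<close>
  then show ?thesis
    using that V_subset unfolding S_def by (fastforce simp: V_bot)
qed

lemma finite_cover_of_Spec:
  fixes C :: "'a::coherent_quantale set"
  assumes C: "C \<subseteq> compact_elements" and cover: "Min_Spec \<subseteq> (\<Union>c\<in>C. V c)"
  obtains F where "finite F" "F \<subseteq> C" "Spec \<subseteq> (\<Union>c\<in>F. V c)"
proof -
  define S where "S = {s \<in> compact_elements. \<exists>F. finite F \<and> F \<subseteq> C \<and> V s \<subseteq> (\<Union>c\<in>F. V c)}"
  have "bot \<in> S"
  proof (rule ccontr)
    assume "bot \<notin> S"
    have mult: "s * t \<in> S" if st: "s \<in> S" "t \<in> S" for s t
    proof -
      obtain F G where "finite F" "F \<subseteq> C" "V s \<subseteq> (\<Union>c\<in>F. V c)"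
        "finite G" "G \<subseteq> C" "V t \<subseteq> (\<Union>c\<in>G. V c)"
        using st unfolding S_def by blast
      then have "finite (F \<union> G)" "F \<union> G \<subseteq> C" "V (s * t) \<subseteq> (\<Union>c\<in>F \<union> G. V c)"
        by (auto simp: V_mult)
      then show ?thesis
        using st mult_compact unfolding S_def by blast
    qed
    \<comment> \<open>The empty family covers \<open>V 1\<close>.\<close>
    have "S \<subseteq> compact_elements" "1 \<in> S"
      using one_compact by (auto simp: S_def V_one)
    from exists_m_prime_avoiding[OF this \<open>bot \<notin> S\<close> mult]
    obtain p where p: "p \<in> Spec" "\<And>s. s \<in> S \<Longrightarrow> \<not> s \<le> p"
      by blast
    obtain q where q: "q \<in> Min_Spec" "q \<le> p"
      using exists_Min_Spec_le[OF p(1)] .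
    then obtain c where c: "c \<in> C" "c \<le> p"
      using cover order_trans unfolding V_def by blast
    then have "finite {c}" "{c} \<subseteq> C" "V c \<subseteq> (\<Union>c\<in>{c}. V c)"
      by auto
    then have "c \<in> S"
      using c(1) C unfolding S_def by blast
    then show False
      using p(2) c(2) by blast
  qed
  then show ?thesis
    using that by (auto simp: S_def V_bot)
qed

section \<open>The subspace topologies on minimal m-primes\<close>

lemma Min_Spec_subset: "Min_Spec \<subseteq> Spec"
  by (auto simp: Min_Spec_def)

lemma topspace_Min_Z: "topspace Min_Z = Min_Spec"
  using Min_Spec_subset by (auto simp: Min_Z_def topspace_Spec_Z)

lemma topspace_Min_F: "topspace Min_F = Min_Spec"
  using Min_Spec_subset by (auto simp: Min_F_def topspace_Spec_F)

lemma openin_Min_Z: "openin Min_Z U \<longleftrightarrow> (\<exists>a. U = Min_Spec - V a)"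
  using Min_Spec_subset unfolding Min_Z_def openin_subtopology openin_Spec_Z by blast

lemma openin_Min_F_V:
  fixes c :: "'a::quantale"
  shows "c \<in> compact_elements \<Longrightarrow> openin Min_F (Min_Spec \<inter> V c)"
  unfolding Min_F_def openin_subtopology_alt openin_Spec_F
  by (blast intro: arbitrary_union_of_inc)

lemma openin_Min_F_base:
  fixes U :: "'a::quantale set"
  assumes "openin Min_F U" "p \<in> U"
  obtains c where "c \<in> compact_elements" "p \<in> V c" "Min_Spec \<inter> V c \<subseteq> U"
  using assms unfolding Min_F_def openin_subtopology openin_Spec_F arbitrary_union_of_alt
  by blast

lemma openin_Min_Z_V:
  fixes c :: "'a::coherent_quantale"
  assumes c: "c \<in> compact_elements"
  shows "openin Min_Z (Min_Spec \<inter> V c)"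
proof (subst openin_subopen, intro ballI)
  fix p assume "p \<in> Min_Spec \<inter> V c"
  then have p: "p \<in> Min_Spec" "c \<le> p"
    by (auto simp: V_def)
  then obtain d where d: "\<not> d \<le> p" "Spec = V c \<union> V d"
    using Min_Spec_complement c by blast
  \<comment> \<open>The complement of \<open>V d\<close> is a neighbourhood of \<open>p\<close>
    inside \<open>V c\<close>, as the two sets cover \<open>Spec\<close>.\<close>
  have "openin Min_Z (Min_Spec - V d)"
    using openin_Min_Z by blast
  moreover have "p \<in> Min_Spec - V d"
    using p d(1) by (simp add: V_def)
  moreover have "Min_Spec - V d \<subseteq> Min_Spec \<inter> V c"
    using d(2) Min_Spec_subset by blast
  ultimately show "\<exists>T. openin Min_Z T \<and> p \<in> T \<and> T \<subseteq> Min_Spec \<inter> V c"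
    by blast
qed

lemma Min_Spec_separation:
  fixes p q :: "'a::coherent_quantale"
  assumes "p \<in> Min_Spec" "q \<in> Min_Spec" "p \<noteq> q"
  obtains c where "c \<in> compact_elements" "p \<in> V c" "q \<notin> V c"
proof -
  have "\<not> p \<le> q"
    using assms unfolding Min_Spec_def by blast
  then obtain c where "c \<in> compact_elements" "c \<le> p" "\<not> c \<le> q"
    using le_if_compact_le by blast
  then show ?thesis
    using that assms Min_Spec_subset unfolding V_def by blast
qed

section \<open>The four topological properties\<close>

lemma zero_dimensional_Min_Z: "zero_dimensional_space (Min_Z :: 'a::coherent_quantale topology)"
proof -
  let ?B = "{Min_Spec - V c | c::'a. c \<in> compact_elements}"
  have clopen: "openin Min_Z B \<and> closedin Min_Z B" if B: "B \<in> ?B" for B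
  proof -
    obtain c where c: "c \<in> compact_elements" "B = Min_Spec - V c"
      using B by blast
    then have "topspace Min_Z - B = Min_Spec \<inter> V c"
      by (auto simp: topspace_Min_Z)
    then show ?thesis
      using c openin_Min_Z openin_Min_Z_V[OF c(1)]
      by (auto simp: closedin_def topspace_Min_Z)
  qed
  have base: "\<exists>B. B \<in> ?B \<and> p \<in> B \<and> B \<subseteq> U" if U: "openin Min_Z U" "p \<in> U" for U p
  proof -
    obtain a where a: "U = Min_Spec - V a"
      using U(1) openin_Min_Z by blast
    then have p: "p \<in> Min_Spec" "\<not> a \<le> p"
      using U(2) Min_Spec_subset by (auto simp: V_def)
    \<comment> \<open>A compact part of \<open>a\<close> already excludes \<open>p\<close>, and
      passing from \<open>a\<close> to \<open>c\<close> shrinks the complement of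
      \<open>V\<close>.\<close>
    then obtain c where c: "c \<in> compact_elements" "c \<le> a" "\<not> c \<le> p"
      using le_if_compact_le by blast
    then have "V a \<subseteq> V c" "p \<notin> V c"
      by (auto simp: V_def)
    then show ?thesis
      using a c(1) p(1) by blast
  qed
  have "openin Min_Z = arbitrary union_of (\<lambda>U. U \<in> ?B)"
    unfolding openin_topology_base_unique
  proof (intro conjI allI impI)
    show "openin Min_Z B" if "B \<in> ?B" for B
      using clopen[OF that] ..
    show "\<exists>B. B \<in> ?B \<and> p \<in> B \<and> B \<subseteq> U" if "openin Min_Z U \<and> p \<in> U" for U p
      using that by (elim conjE) (rule base)
  qed
  with clopen show ?thesis
    unfolding zero_dimensional_space_def by (intro exI[of _ ?B]) simp
qed

lemma Hausdorff_Min_Z: "Hausdorff_space (Min_Z :: 'a::coherent_quantale topology)"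
  unfolding Hausdorff_space_def topspace_Min_Z
proof (intro allI impI, elim conjE)
  fix p q :: 'a assume pq: "p \<in> Min_Spec" "q \<in> Min_Spec" "p \<noteq> q"
  then obtain c where c: "c \<in> compact_elements" "p \<in> V c" "q \<notin> V c"
    by (rule Min_Spec_separation)
  have "openin Min_Z (Min_Spec - V c)"
    using openin_Min_Z by blast
  moreover have "p \<in> Min_Spec \<inter> V c" "q \<in> Min_Spec - V c"
    "disjnt (Min_Spec \<inter> V c) (Min_Spec - V c)"
    using pq c by (auto simp: disjnt_def)
  ultimately show "\<exists>U W. openin Min_Z U \<and> openin Min_Z W \<and> p \<in> U \<and> q \<in> W \<and> disjnt U W"
    using openin_Min_Z_V[OF c(1)] by blast
qed

lemma compact_Min_F: "compact_space (Min_F :: 'a::coherent_quantale topology)"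
  unfolding compact_space_alt topspace_Min_F
proof (intro allI impI, elim conjE)
  fix \<U> :: "'a set set"
  assume U: "\<forall>U\<in>\<U>. openin Min_F U" and cover: "Min_Spec \<subseteq> \<Union>\<U>"
  \<comment> \<open>The basic sets inside some member of the cover form a refinement; a finite
    subcover of it lifts back through \<open>f\<close>.\<close>
  define C where "C = {c \<in> compact_elements. \<exists>U\<in>\<U>. Min_Spec \<inter> V c \<subseteq> U}"
  have "Min_Spec \<subseteq> (\<Union>c\<in>C. V c)"
  proof
    fix p :: 'a assume "p \<in> Min_Spec"
    then obtain W where W: "W \<in> \<U>" "p \<in> W" using cover by blast
    then obtain c where "c \<in> compact_elements" "p \<in> V c" "Min_Spec \<inter> V c \<subseteq> W"
      using U openin_Min_F_base by metis
    then show "p \<in> (\<Union>c\<in>C. V c)"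
      using W unfolding C_def by blast
  qed
  then obtain F where F: "finite F" "F \<subseteq> C" "Spec \<subseteq> (\<Union>c\<in>F. V c)"
    by (rule finite_cover_of_Spec[rotated]) (auto simp: C_def)
  have "\<forall>c\<in>C. \<exists>U. U \<in> \<U> \<and> Min_Spec \<inter> V c \<subseteq> U"
    unfolding C_def by blast
  then obtain f where f: "\<And>c. c \<in> C \<Longrightarrow> f c \<in> \<U> \<and> Min_Spec \<inter> V c \<subseteq> f c"
    by metis
  have "finite (f ` F)" "f ` F \<subseteq> \<U>"
    using F f by auto
  moreover have "Min_Spec \<subseteq> \<Union>(f ` F)"
    using F(2,3) f Min_Spec_subset by blast
  ultimately show "\<exists>\<F>. finite \<F> \<and> \<F> \<subseteq> \<U> \<and> Min_Spec \<subseteq> \<Union>\<F>"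
    by blast
qed

lemma t1_Min_F: "t1_space (Min_F :: 'a::coherent_quantale topology)"
  unfolding t1_space_def topspace_Min_F
proof (intro ballI impI)
  fix p q :: 'a assume pq: "p \<in> Min_Spec" "q \<in> Min_Spec" "p \<noteq> q"
  then obtain c where "c \<in> compact_elements" "p \<in> V c" "q \<notin> V c"
    by (rule Min_Spec_separation)
  then show "\<exists>U. openin Min_F U \<and> p \<in> U \<and> q \<notin> U"
    using openin_Min_F_V[of c] pq by blast
qed

theorem corollary8p6:
  shows "zero_dimensional_space (Min_Z :: 'a::coherent_quantale topology)
       \<and> Hausdorff_space (Min_Z :: 'a topology)
       \<and> compact_space (Min_F :: 'a topology)
       \<and> t1_space (Min_F :: 'a topology)"
  using zero_dimensional_Min_Z Hausdorff_Min_Z compact_Min_F t1_Min_F by blast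

end
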